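(* Let $\rho>0$ and $\beta>0$. Then the radius of uniform convexity of $g_{\rho,\beta}$ is the smallest positive root $r$ of the equation $$1+2r\frac{g_{\rho,\beta}''(r)}{g_{\rho,\beta}'(r)}=0.$$
   Context: The Wright function is $\phi(\rho,\beta,z)=\sum_{n\geq0}\frac{z^n}{n!\,\Gamma(n\rho+\beta)}$ for $\rho>-1$, $z,\beta\in\mathbb{C}$. For $\rho>0,\beta>0$ define $g_{\rho,\beta}(z)=z\,\Gamma(\beta)\,\phi(\rho,\beta,-z^2)$. For an analytic function $f$ with $f(0)=0,f'(0)=1$, its radius of uniform convexity is $r^{uc}(f)=\sup\{r>0: f \text{ is analytic on } \mathbb{D}_r,\ f'\neq0 \text{ on } \mathbb{D}_r, \text{ and } \Re\big(1+\tfrac{zf''(z)}{f'(z)}\big)>\big|\tfrac{zf''(z)}{f'(z)}\big| \text{ for all } z\in\mathbb{D}_r\}$, where $\mathbb{D}_r=\{z\in\mathbb{C}:|z|<r\}$. *)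

theory Defs
  imports "HOL-Analysis.Analysis"
begin

text \<open>Wright function phi(rho,beta,z) = sum_n z^n / (n! Gamma(n rho + beta)); 1/Gamma is rGamma
  (entire, zero at the poles of Gamma).\<close>
definition wright :: "real \<Rightarrow> complex \<Rightarrow> complex \<Rightarrow> complex" where
  "wright \<rho> \<beta> z = (\<Sum>n. z ^ n * rGamma (of_real (real n * \<rho>) + \<beta>) / of_nat (fact n))"

definition g_wright :: "real \<Rightarrow> real \<Rightarrow> complex \<Rightarrow> complex" where
  "g_wright \<rho> \<beta> z = z * of_real (Gamma \<beta>) * wright \<rho> (of_real \<beta>) (- (z ^ 2))"

definition radius_uc :: "(complex \<Rightarrow> complex) \<Rightarrow> ereal" where
  "radius_uc f = Sup (ereal ` {r. r > 0 \<and> f analytic_on ball 0 r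
      \<and> (\<forall>z\<in>ball 0 r. deriv f z \<noteq> 0)
      \<and> (\<forall>z\<in>ball 0 r. Re (1 + z * deriv (deriv f) z / deriv f z)
                         > cmod (z * deriv (deriv f) z / deriv f z))})"

end

theory Submission
  imports Defs
    "HOL-Complex_Analysis.Cauchy_Integral_Formula"
    "HOL-Computational_Algebra.Fundamental_Theorem_Algebra"
begin

text \<open>
  Write \<open>g'(z) = F(z\<^sup>2)\<close>, so that \<open>z g''(z) / g'(z) = 2 w F'(w) / F(w)\<close> for \<open>w = z\<^sup>2\<close>. For a polynomial
  whose zeros are all positive, the partial fraction \<open>- w p'(w) / p(w) = \<Sum> w / (x - w)\<close> is dominated
  in modulus by its value at \<open>\<bar>w\<bar>\<close> as long as \<open>\<bar>w\<bar>\<close> is below all zeros \<open>x\<close>. This passes to locally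
  uniform limits, and \<open>F\<close> is such a limit: by Euler's product for \<open>1 / \<Gamma>\<close>, its coefficients arise from
  those of \<open>(1 - s w)^m\<close> by repeatedly applying \<open>p \<mapsto> \<rho> w p' + c p\<close> with \<open>\<rho>, c > 0\<close>, which preserves
  positivity of the zeros (Laguerre). Hence \<open>\<bar>z g'' / g'\<bar>\<close> is largest, and \<open>z g'' / g'\<close> is negative, at
  \<open>z = \<bar>z\<bar>\<close>, so that the condition for uniform convexity first fails where \<open>r g''(r) / g'(r) = - 1/2\<close>.
\<close>

section \<open>Polynomials with only positive zeros\<close>

definition positive_rooted :: "complex poly \<Rightarrow> bool" where
  "positive_rooted p \<longleftrightarrow> p \<noteq> 0 \<and> (\<forall>z. poly p z = 0 \<longrightarrow> (\<exists>x>0. z = complex_of_real x))"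

lemma positive_rooted_factor:
  assumes "positive_rooted p"
  obtains A c where "p = smult c (\<Prod>x\<in>#A. [:- complex_of_real x, 1:])"
    "\<And>x. x \<in># A \<Longrightarrow> x > 0"
proof -
  obtain B where B: "p = smult (lead_coeff p) (\<Prod>z\<in>#B. [:- z, 1:])"
    using complex_poly_decompose_multiset[of p] by metis
  have pos: "\<exists>x>0. z = complex_of_real x" if "z \<in># B" for z
  proof -
    have "poly p z = 0"
      by (subst B) (use that in \<open>auto simp: poly_prod_mset image_iff\<close>)
    with assms show ?thesis by (simp add: positive_rooted_def)
  qed
  define A where "A = image_mset Re B"
  have "image_mset complex_of_real A = image_mset (\<lambda>z. z) B"
    unfolding A_def multiset.map_comp by (rule image_mset_cong) (use pos in force)
  then have BA: "B = image_mset complex_of_real A" by simp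
  show ?thesis
  proof
    show "p = smult (lead_coeff p) (\<Prod>x\<in>#A. [:- complex_of_real x, 1:])"
      by (subst B) (simp add: BA multiset.map_comp comp_def)
    show "x > 0" if "x \<in># A" for x
      using that pos by (force simp: A_def)
  qed
qed

lemma poly_prod_linear:
  "poly (smult c (\<Prod>x\<in>#A. [:- complex_of_real x, 1:])) z = c * (\<Prod>x\<in>#A. z - of_real x)"
  by (simp add: poly_prod_mset multiset.map_comp comp_def)

lemma poly_pderiv_prod_linear:
  assumes "\<And>x. x \<in># A \<Longrightarrow> z \<noteq> of_real x"
  shows "poly (pderiv (\<Prod>x\<in>#A. [:- complex_of_real x, 1:])) z
    = (\<Prod>x\<in>#A. z - of_real x) * (\<Sum>x\<in>#A. 1 / (z - of_real x))"
  using assms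
proof (induction A)
  case (add y A)
  define Q where "Q = (\<Prod>x\<in>#A. [:- complex_of_real x, 1:])"
  define P where "P = (\<Prod>x\<in>#A. z - complex_of_real x)"
  define S where "S = (\<Sum>x\<in>#A. 1 / (z - complex_of_real x))"
  have "z - of_real y \<noteq> 0" using add.prems by simp
  moreover have "poly (pderiv Q) z = P * S" "poly Q z = P"
    using add poly_prod_linear[of 1 A z] by (simp_all add: Q_def P_def S_def)
  moreover have "poly (pderiv ([:- of_real y, 1:] * Q)) z
      = (z - of_real y) * poly (pderiv Q) z + poly Q z"
    by (simp add: pderiv_mult pderiv_pCons del: mult_pCons_left)
  ultimately have "poly (pderiv ([:- of_real y, 1:] * Q)) z
      = (z - of_real y) * P * (1 / (z - of_real y) + S)"
    by (simp add: distrib_left)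
  then show ?case by (simp add: Q_def P_def S_def del: mult_pCons_left)
qed simp

lemma logderiv_prod_linear:
  assumes "p = smult c (\<Prod>x\<in>#A. [:- complex_of_real x, 1:])" "poly p z \<noteq> 0"
  shows "poly (pderiv p) z / poly p z = (\<Sum>x\<in>#A. 1 / (z - of_real x))"
proof -
  have ev: "poly p z = c * (\<Prod>x\<in>#A. z - of_real x)"
    unfolding assms(1) by (rule poly_prod_linear)
  have "z \<noteq> of_real x" if "x \<in># A" for x
    using assms(2) that unfolding ev by (auto simp: image_iff)
  then have "poly (pderiv p) z = poly p z * (\<Sum>x\<in>#A. 1 / (z - of_real x))"
    unfolding ev unfolding assms(1) pderiv_smult poly_smult
    by (subst poly_pderiv_prod_linear) auto
  with assms(2) show ?thesis by simp
qed

lemma Im_divide_diff_real: "Im (z / (z - of_real x)) = - (x * Im z) / (cmod (z - of_real x))\<^sup>2"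
proof -
  have "Im z * (Re z - x) - Re z * Im z = - (x * Im z)" by algebra
  then show ?thesis by (simp add: Im_divide cmod_power2)
qed

text \<open>A zero \<open>z\<close> of \<open>c p + \<rho> w p'\<close> with \<open>p(z) \<noteq> 0\<close> satisfies
  \<open>\<Sum> z / (z - x) = - c / \<rho>\<close>, where every summand has imaginary part of the sign of \<open>- Im z\<close>
  and is nonnegative for \<open>z \<le> 0\<close>.\<close>
lemma positive_rooted_euler:
  assumes p: "positive_rooted p" and "\<rho> > 0" "c > 0"
  shows "positive_rooted (smult (of_real c) p + smult (of_real \<rho>) (pCons 0 (pderiv p)))"
    (is "positive_rooted ?q")
proof -
  obtain A k where p_eq: "p = smult k (\<Prod>x\<in>#A. [:- complex_of_real x, 1:])"
    and pos: "\<And>x. x \<in># A \<Longrightarrow> x > 0"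
    using positive_rooted_factor[OF p] by metis
  have eval: "poly ?q z = of_real c * poly p z + of_real \<rho> * z * poly (pderiv p) z" for z
    by simp
  have "poly p 0 \<noteq> 0" using p by (force simp: positive_rooted_def)
  then have "poly ?q 0 \<noteq> 0" using \<open>c > 0\<close> by (simp add: eval)
  then have "?q \<noteq> 0" by (metis poly_0)
  moreover have "\<exists>x>0. z = complex_of_real x" if z: "poly ?q z = 0" for z
  proof (cases "poly p z = 0")
    case True
    then show ?thesis using p by (simp add: positive_rooted_def)
  next
    case False
    have "of_real \<rho> * (z * (poly (pderiv p) z / poly p z)) = - of_real c"
      using z False unfolding eval by (simp add: divide_simps) (simp add: add_eq_0_iff algebra_simps)
    then have "of_real \<rho> * (\<Sum>x\<in>#A. z / (z - of_real x)) = - of_real c"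
      unfolding logderiv_prod_linear[OF p_eq False]
      by (simp add: sum_mset_distrib_left)
    then have S: "(\<Sum>x\<in>#A. z / (z - of_real x)) = of_real (- c / \<rho>)"
      using \<open>\<rho> > 0\<close> by (simp add: field_simps)
    have ne: "z \<noteq> of_real x" if "x \<in># A" for x
      using False that unfolding p_eq poly_prod_linear by (auto simp: image_iff)
    have "Im z = 0"
    proof (rule ccontr)
      assume "Im z \<noteq> 0"
      \<comment> \<open>The empty sum escapes the strict inequality, hence the disjunction. For
        \<open>B = A\<close> either alternative contradicts \<open>S\<close>, whose right side is
        real and nonzero.\<close>
      have "B = {#} \<or> Im (\<Sum>x\<in>#B. z / (z - of_real x)) * Im z < 0" if "B \<subseteq># A" for B
        using that
      proof (induction B)
        case (add y B)
        have "y \<in># A" using add.prems by (simp add: insert_subset_eq_iff)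
        then have "y > 0" and "z \<noteq> of_real y" using pos ne by auto
        have "Im (z / (z - of_real y)) * Im z = - (y * (Im z)\<^sup>2) / (cmod (z - of_real y))\<^sup>2"
          by (simp add: Im_divide_diff_real power2_eq_square)
        also have "\<dots> < 0"
          using \<open>y > 0\<close> \<open>z \<noteq> of_real y\<close> \<open>Im z \<noteq> 0\<close> by (simp add: divide_simps)
        finally have 1: "Im (z / (z - of_real y)) * Im z < 0" .
        have "B \<subseteq># A" using add.prems by (metis mset_subset_eq_insertD subset_mset.less_imp_le)
        with add.IH 1 show ?case by (auto simp: distrib_right simp del: times_divide_eq_left)
      qed simp
      from this[of A] S show False using \<open>c > 0\<close> \<open>\<rho> > 0\<close> by auto
    qed
    then have z_eq: "z = of_real (Re z)" by (simp add: complex_eq_iff)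
    have "Re z > 0"
    proof (rule ccontr)
      assume "\<not> Re z > 0"
      have "(\<Sum>x\<in>#A. z / (z - of_real x)) = of_real (\<Sum>x\<in>#A. Re z / (Re z - x))"
        by (subst (1 2) z_eq) (induction A; simp)
      then have "(\<Sum>x\<in>#A. Re z / (Re z - x)) = - c / \<rho>"
        unfolding S using of_real_eq_iff by metis
      moreover have "(\<Sum>x\<in>#A. Re z / (Re z - x)) \<ge> 0"
        using pos
      proof (induction A)
        case (add y A)
        have "y > 0" using add.prems by simp
        then have "Re z / (Re z - y) \<ge> 0"
          using \<open>\<not> Re z > 0\<close> by (intro divide_nonpos_nonpos) auto
        with add show ?case by simp
      qed simp
      moreover have "- c / \<rho> < 0" using \<open>c > 0\<close> \<open>\<rho> > 0\<close> by simp
      ultimately show False by linarith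
    qed
    with z_eq show ?thesis by blast
  qed
  ultimately show ?thesis by (auto simp: positive_rooted_def)
qed

text \<open>On coefficients the operator is a diagonal multiplier, so iterating it with
  \<open>c = \<beta> + k\<close> builds Pochhammer symbols in \<open>n * \<rho> + \<beta>\<close>,
  and the constants 2 and 1 produce the factor \<open>2 * n + 1\<close>.\<close>

lemma coeff_euler:
  "coeff (smult c p + smult \<rho> (pCons 0 (pderiv p))) n = (\<rho> * of_nat n + c) * coeff p n"
  for p :: "complex poly"
  by (cases n) (simp_all add: coeff_pderiv algebra_simps)

section \<open>Extremal estimates on discs that reach no zero\<close>

context
  fixes p :: "complex poly" and T :: real
  assumes p: "positive_rooted p"
    and nz: "\<And>t. 0 \<le> t \<Longrightarrow> t \<le> T \<Longrightarrow> poly p (of_real t) \<noteq> 0"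
begin

lemma positive_rooted_factor_gt:
  obtains A c where "p = smult c (\<Prod>x\<in>#A. [:- complex_of_real x, 1:])" "\<And>x. x \<in># A \<Longrightarrow> x > T"
proof -
  obtain A k where p_eq: "p = smult k (\<Prod>x\<in>#A. [:- complex_of_real x, 1:])"
    and pos: "\<And>x. x \<in># A \<Longrightarrow> x > 0"
    using positive_rooted_factor[OF p] by metis
  have "x > T" if "x \<in># A" for x
  proof (rule ccontr)
    assume "\<not> x > T"
    then have "poly p (of_real x) \<noteq> 0" using nz[of x] pos[OF that] by simp
    then show False using that unfolding p_eq poly_prod_linear by (auto simp: image_iff)
  qed
  with p_eq show ?thesis using that by blast
qed

text \<open>All zeros \<open>x\<close> exceed \<open>T\<close>, so by the reverse triangle
  inequality each factor \<open>w - x\<close> has modulus at least \<open>x - cmod w\<close>, with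
  equality at the point \<open>cmod w\<close>.\<close>

lemma positive_rooted_norm_ge:
  assumes w: "cmod w \<le> T"
  shows "cmod (poly p (of_real (cmod w))) \<le> cmod (poly p w)"
proof -
  obtain A k where p_eq: "p = smult k (\<Prod>x\<in>#A. [:- complex_of_real x, 1:])"
    and pos: "\<And>x. x \<in># A \<Longrightarrow> x > T"
    using positive_rooted_factor_gt by metis
  have "cmod (of_real (cmod w) - of_real x) \<le> cmod (w - of_real x)" if "x > T" for x
  proof -
    have "cmod (of_real (cmod w) - of_real x) = x - cmod w"
      using that w by (simp flip: of_real_diff)
    then show ?thesis using norm_triangle_ineq2[of "of_real x" w] that w
      by (simp add: norm_minus_commute)
  qed
  then have "cmod (\<Prod>x\<in>#A. of_real (cmod w) - of_real x) \<le> cmod (\<Prod>x\<in>#A. w - of_real x)"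
    using pos by (induction A) (auto simp: norm_mult intro!: mult_mono)
  then show ?thesis unfolding p_eq poly_prod_linear by (simp add: norm_mult mult_left_mono)
qed

text \<open>In the partial fraction, \<open>1 / (w - x)\<close> has modulus at most
  \<open>1 / (x - cmod w)\<close>. At the point \<open>cmod w\<close> all summands are negative
  reals, so nothing is lost there by the triangle inequality.\<close>

lemma positive_rooted_logderiv:
  assumes w: "cmod w \<le> T"
  shows "cmod (w * (poly (pderiv p) w / poly p w)) \<le>
    - (cmod w * Re (poly (pderiv p) (of_real (cmod w)) / poly p (of_real (cmod w))))"
proof -
  obtain A k where p_eq: "p = smult k (\<Prod>x\<in>#A. [:- complex_of_real x, 1:])"
    and pos: "\<And>x. x \<in># A \<Longrightarrow> x > T"
    using positive_rooted_factor_gt by metis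
  have nz1: "poly p (of_real (cmod w)) \<noteq> 0" using nz w by simp
  with positive_rooted_norm_ge[OF w] have nz2: "poly p w \<noteq> 0" by auto
  have "cmod (1 / (w - of_real x)) \<le> - Re (1 / (of_real (cmod w) - of_real x))" if "x > T" for x
  proof -
    have "x - cmod w \<le> cmod (w - of_real x)"
      using norm_triangle_ineq2[of "of_real x" w] that w by (simp add: norm_minus_commute)
    then have "1 / cmod (w - of_real x) \<le> 1 / (x - cmod w)"
      using that w by (intro divide_left_mono mult_pos_pos) auto
    also have "\<dots> = - Re (of_real (1 / (cmod w - x)))"
      using that w unfolding Re_complex_of_real by (simp add: divide_simps)
    finally show ?thesis by (simp add: norm_divide)
  qed
  then have "cmod (\<Sum>x\<in>#A. 1 / (w - of_real x)) \<le> - Re (\<Sum>x\<in>#A. 1 / (of_real (cmod w) - of_real x))"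
    using pos
  proof (induction A)
    case (add y A)
    let ?S = "\<lambda>w. \<Sum>x\<in>#A. 1 / (w - of_real x)"
    have "cmod (1 / (w - of_real y) + ?S w) \<le> cmod (1 / (w - of_real y)) + cmod (?S w)"
      by (rule norm_triangle_ineq)
    also have "\<dots> \<le> - Re (1 / (of_real (cmod w) - of_real y)) + - Re (?S (of_real (cmod w)))"
    proof (rule add_mono)
      show "cmod (1 / (w - of_real y)) \<le> - Re (1 / (of_real (cmod w) - of_real y))"
        using add.prems by simp
      show "cmod (?S w) \<le> - Re (?S (of_real (cmod w)))"
        using add by simp
    qed
    finally show ?case by simp
  qed simp
  then have "cmod w * cmod (\<Sum>x\<in>#A. 1 / (w - of_real x)) \<le>
      cmod w * - Re (\<Sum>x\<in>#A. 1 / (of_real (cmod w) - of_real x))"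
    by (rule mult_left_mono) simp
  then show ?thesis
    unfolding norm_mult logderiv_prod_linear[OF p_eq nz1] logderiv_prod_linear[OF p_eq nz2]
    by simp
qed

text \<open>Each summand \<open>1 / (t - x)\<close> decreases in \<open>t\<close> below
  \<open>x\<close>. In the limit this keeps the logarithmic derivative of F away from 0 on the
  positive axis, which later forces the equation to have a root.\<close>

lemma positive_rooted_logderiv_mono:
  assumes "0 \<le> T"
  shows "Re (poly (pderiv p) (of_real T) / poly p (of_real T)) \<le> Re (poly (pderiv p) 0 / poly p 0)"
proof -
  obtain A k where p_eq: "p = smult k (\<Prod>x\<in>#A. [:- complex_of_real x, 1:])"
    and pos: "\<And>x. x \<in># A \<Longrightarrow> x > T"
    using positive_rooted_factor_gt by metis
  have nz1: "poly p (of_real T) \<noteq> 0" "poly p 0 \<noteq> 0" using nz[of T] nz[of 0] assms by simp_all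
  have "Re (1 / (of_real T - of_real x)) \<le> Re (1 / (0 - of_real x))" if "x > T" for x
  proof -
    have "1 / (T - x) \<le> 1 / (0 - x)" using that assms by (simp add: divide_simps)
    then have "Re (of_real (1 / (T - x))) \<le> Re (of_real (1 / (0 - x)))"
      unfolding Re_complex_of_real .
    then show ?thesis by simp
  qed
  then have "Re (\<Sum>x\<in>#A. 1 / (of_real T - of_real x)) \<le> Re (\<Sum>x\<in>#A. 1 / (0 - of_real x))"
    using pos by (induction A) (force intro!: add_mono)+
  then show ?thesis
    unfolding logderiv_prod_linear[OF p_eq nz1(1)] logderiv_prod_linear[OF p_eq nz1(2)] .
qed

end

section \<open>Entire limits of polynomials with positive zeros\<close>

lemma poly_sums_coeff: "(\<lambda>n. coeff p n * w ^ n) sums poly p w" for p :: "complex poly"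
  unfolding poly_altdef by (rule sums_finite) (auto simp: coeff_eq_0)

lemma summable_exp_bound: "summable (\<lambda>n. C * q ^ n / fact n * R ^ n :: real)"
  using summable_mult[OF summable_exp[of "q * R"], of C]
  by (simp add: power_mult_distrib field_simps)

text \<open>Real coefficients make the function and its derivative real on the real axis, so that
  the search for the root is a matter of real analysis.\<close>

definition real_powser :: "(nat \<Rightarrow> real) \<Rightarrow> complex \<Rightarrow> complex" where
  "real_powser a w = (\<Sum>n. of_real (a n) * w ^ n)"

context
  fixes a :: "nat \<Rightarrow> real" and P :: "nat \<Rightarrow> complex poly" and C q :: real
  assumes lim: "\<And>n. (\<lambda>m. coeff (P m) n) \<longlonglongrightarrow> of_real (a n)"
    and bound: "\<And>m n. cmod (coeff (P m) n) \<le> C * q ^ n / fact n"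
    and pos: "\<And>m. positive_rooted (P m)"
begin

lemma coeff_limit_bound: "\<bar>a n\<bar> \<le> C * q ^ n / fact n"
proof -
  have "(\<lambda>m. cmod (coeff (P m) n)) \<longlonglongrightarrow> \<bar>a n\<bar>"
    using tendsto_norm[OF lim[of n]] by simp
  then show ?thesis by (rule LIMSEQ_le_const2) (use bound in auto)
qed

lemma summable_coeff_limit: "summable (\<lambda>n. of_real (a n) * z ^ n :: 'a::{real_normed_field,banach})"
proof (rule summable_comparison_test')
  show "summable (\<lambda>n. C * q ^ n / fact n * norm z ^ n)" by (rule summable_exp_bound)
  show "norm (of_real (a n) * z ^ n) \<le> C * q ^ n / fact n * norm z ^ n" for n
    unfolding norm_mult norm_power norm_of_real by (intro mult_right_mono coeff_limit_bound) simp
qed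

text \<open>On the disc the distance is at most the series of coefficient differences at radius
  \<open>\<bar>R\<bar>\<close>. Tannery's theorem sends that series to 0, with the common bound on
  the coefficients as majorant.\<close>

lemma uniform_limit_poly:
  "uniform_limit (cball 0 R) (\<lambda>m. poly (P m)) (\<lambda>w. \<Sum>n. of_real (a n) * w ^ n) sequentially"
proof (rule uniform_limitI)
  fix e :: real
  assume "e > 0"
  let ?d = "\<lambda>n m. cmod (coeff (P m) n - of_real (a n))"
  have d: "?d n m \<le> 2 * C * q ^ n / fact n" for n m
    using norm_triangle_ineq4[of "coeff (P m) n" "of_real (a n)"] bound[of m n] coeff_limit_bound[of n]
    by simp
  have dR: "?d n m * R' ^ n \<le> 2 * C * q ^ n / fact n * R' ^ n" if "R' \<ge> 0" for n m R'
    by (rule mult_right_mono) (use d that in auto)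
  have sd: "summable (\<lambda>n. ?d n m * R' ^ n)" if "R' \<ge> 0" for R' m
    using summable_exp_bound[of "2 * C" q R']
    by (rule summable_comparison_test') (use dR[OF that] that in simp)
  have "(\<lambda>m. \<Sum>n. ?d n m * \<bar>R\<bar> ^ n) \<longlonglongrightarrow> (\<Sum>n. 0)"
  proof (rule conjunct2[OF conjunct2[OF tannerys_theorem]])
    show "(\<lambda>m. ?d n m * \<bar>R\<bar> ^ n) \<longlonglongrightarrow> 0" for n
      using lim[of n] by (intro tendsto_mult_left_zero tendsto_norm_zero) (simp add: LIM_zero)
    show "summable (\<lambda>n. 2 * C * q ^ n / fact n * \<bar>R\<bar> ^ n)" by (rule summable_exp_bound)
    show "\<forall>\<^sub>F (n, m) in sequentially \<times>\<^sub>F sequentially.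
        norm (?d n m * \<bar>R\<bar> ^ n) \<le> 2 * C * q ^ n / fact n * \<bar>R\<bar> ^ n"
      by (intro always_eventually) (use dR[of "\<bar>R\<bar>"] in \<open>simp add: abs_mult split: prod.split\<close>)
  qed simp
  then have "\<forall>\<^sub>F m in sequentially. (\<Sum>n. ?d n m * \<bar>R\<bar> ^ n) < e"
    using \<open>e > 0\<close> by (auto intro: order_tendstoD)
  then show "\<forall>\<^sub>F m in sequentially. \<forall>w\<in>cball 0 R. dist (poly (P m) w) (\<Sum>n. of_real (a n) * w ^ n) < e"
  proof eventually_elim
    case (elim m)
    show ?case
    proof
      fix w :: complex
      assume w: "w \<in> cball 0 R"
      have "(\<lambda>n. coeff (P m) n * w ^ n - of_real (a n) * w ^ n) sums
          (poly (P m) w - (\<Sum>n. of_real (a n) * w ^ n))"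
        by (intro sums_diff poly_sums_coeff summable_sums summable_coeff_limit)
      then have "dist (poly (P m) w) (\<Sum>n. of_real (a n) * w ^ n)
          = cmod (\<Sum>n. (coeff (P m) n - of_real (a n)) * w ^ n)"
        by (simp add: dist_norm sums_iff left_diff_distrib)
      also have "\<dots> \<le> (\<Sum>n. ?d n m * \<bar>R\<bar> ^ n)"
        by (rule norm_suminf_le)
          (use w sd in \<open>auto simp: norm_mult norm_power intro!: mult_left_mono power_mono\<close>)
      finally show "dist (poly (P m) w) (\<Sum>n. of_real (a n) * w ^ n) < e" using elim by simp
    qed
  qed
qed

lemma poly_tendsto_real_powser: "(\<lambda>m. poly (P m) w) \<longlonglongrightarrow> real_powser a w"
  unfolding real_powser_def by (rule tendsto_uniform_limitI[OF uniform_limit_poly[of "cmod w"]]) simp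

text \<open>Weierstrass: derivatives of locally uniformly convergent holomorphic functions converge
  too. Radius \<open>cmod w + 1\<close> puts \<open>w\<close> inside an open disc.\<close>

lemma pderiv_tendsto_real_powser: "(\<lambda>m. poly (pderiv (P m)) w) \<longlonglongrightarrow> deriv (real_powser a) w"
proof -
  have "(\<lambda>m. deriv (poly (P m)) w) \<longlonglongrightarrow> deriv (real_powser a) w"
  proof (rule deriv_complex_uniform_limit)
    show "uniform_limit (ball 0 (cmod w + 1)) (\<lambda>m. poly (P m)) (real_powser a) sequentially"
      unfolding real_powser_def
      by (rule uniform_limit_on_subset[OF uniform_limit_poly[of "cmod w + 1"]]) auto
    show "\<forall>\<^sub>F m in sequentially. poly (P m) holomorphic_on ball 0 (cmod w + 1)"
      by (intro always_eventually allI holomorphic_intros)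
  qed auto
  then show ?thesis by (simp add: DERIV_imp_deriv[OF poly_DERIV])
qed

lemma real_powser_field_derivative: "(real_powser a has_field_derivative (\<Sum>n. of_real (diffs a n) * w ^ n)) (at w)"
proof -
  have "real_powser a = (\<lambda>w. \<Sum>n. of_real (a n) * w ^ n)"
    by (rule ext) (rule real_powser_def)
  moreover have "(\<lambda>n. complex_of_real (diffs a n)) = diffs (\<lambda>n. of_real (a n))"
    by (rule diffs_of_real[symmetric])
  ultimately show ?thesis
    using termdiffs_strong_converges_everywhere[of "\<lambda>n. complex_of_real (a n)", OF summable_coeff_limit]
    by metis
qed

lemma holomorphic_real_powser: "real_powser a holomorphic_on S"
  using real_powser_field_derivative
  by (meson field_differentiable_at_within field_differentiable_def holomorphic_on_def)

lemma real_powser_of_real: "real_powser a (of_real t) = of_real (\<Sum>n. a n * t ^ n)"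
  unfolding real_powser_def using summable_coeff_limit[of t]
  by (simp flip: of_real_power of_real_mult add: suminf_of_real)

lemma real_field_derivative:
  "((\<lambda>t. \<Sum>n. a n * t ^ n) has_field_derivative (\<Sum>n. diffs a n * t ^ n)) (at t)" for t :: real
  using summable_coeff_limit[where ?'a = real]
  by (intro termdiffs_strong_converges_everywhere) simp

lemma isCont_real_derivative: "isCont (\<lambda>t. \<Sum>n. diffs a n * t ^ n) t" for t :: real
  using summable_coeff_limit[where ?'a = real]
  by (intro isCont_powser_converges_everywhere termdiff_converges_all) simp

lemma deriv_real_powser_of_real: "deriv (real_powser a) (of_real t) = of_real (\<Sum>n. diffs a n * t ^ n)"
proof -
  have "summable (\<lambda>n. diffs a n * t ^ n)"
    using summable_coeff_limit[where ?'a = real] by (intro termdiff_converges_all) simp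
  then show ?thesis
    unfolding DERIV_imp_deriv[OF real_powser_field_derivative]
    by (simp flip: of_real_power of_real_mult add: suminf_of_real)
qed

context
  fixes T :: real
  assumes nz: "\<And>t. 0 \<le> t \<Longrightarrow> t \<le> T \<Longrightarrow> real_powser a (of_real t) \<noteq> 0"
begin

text \<open>On the compact segment the modulus of the limit has a positive minimum. Uniform
  approximation to within that minimum excludes zeros, so the polynomial estimates apply for all
  large \<open>m\<close>.\<close>

lemma eventually_poly_nonzero:
  "\<forall>\<^sub>F m in sequentially. \<forall>t. 0 \<le> t \<longrightarrow> t \<le> T \<longrightarrow> poly (P m) (of_real t) \<noteq> 0"
proof (cases "0 \<le> T")
  case True
  have "continuous_on {0..T} (\<lambda>t. cmod (real_powser a (of_real t)))"
    by (intro continuous_intros continuous_on_compose2[OF holomorphic_on_imp_continuous_on[OF holomorphic_real_powser[of UNIV]]])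
      auto
  then obtain t0 where t0: "t0 \<in> {0..T}"
    and min: "\<And>t. t \<in> {0..T} \<Longrightarrow> cmod (real_powser a (of_real t0)) \<le> cmod (real_powser a (of_real t))"
    using continuous_attains_inf[of "{0..T}"] True by fastforce
  have "cmod (real_powser a (of_real t0)) > 0" using nz t0 by simp
  from uniform_limitD[OF uniform_limit_poly[of T] this]
  show ?thesis
  proof eventually_elim
    case (elim m)
    show ?case
    proof (intro allI impI notI)
      fix t
      assume t: "0 \<le> t" "t \<le> T" and "poly (P m) (of_real t) = 0"
      then have "dist 0 (real_powser a (of_real t)) < cmod (real_powser a (of_real t0))"
        using elim[rule_format, of "of_real t"] by (simp add: real_powser_def)
      with min[of t] t show False by simp
    qed
  qed
qed simp

text \<open>A limit of nonzero values may vanish, but the weak inequality of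
  \<open>positive_rooted_norm_ge\<close> survives the limit and compares \<open>w\<close> with the
  point \<open>cmod w\<close>, where the limit is nonzero by assumption.\<close>

lemma real_powser_nonzero:
  assumes w: "cmod w \<le> T"
  shows "real_powser a w \<noteq> 0"
proof -
  have "\<forall>\<^sub>F m in sequentially. cmod (poly (P m) (of_real (cmod w))) \<le> cmod (poly (P m) w)"
    using eventually_poly_nonzero
    by eventually_elim (use pos w in \<open>blast intro: positive_rooted_norm_ge\<close>)
  then have "cmod (real_powser a (of_real (cmod w))) \<le> cmod (real_powser a w)"
    by (rule tendsto_le[OF sequentially_bot tendsto_norm tendsto_norm, rotated 2])
      (rule poly_tendsto_real_powser)+
  with nz[of "cmod w"] w show ?thesis by auto
qed

lemma logderiv_tendsto:
  "cmod w \<le> T \<Longrightarrow> (\<lambda>m. poly (pderiv (P m)) w / poly (P m) w) \<longlonglongrightarrow> deriv (real_powser a) w / real_powser a w"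
  by (intro tendsto_divide pderiv_tendsto_real_powser poly_tendsto_real_powser real_powser_nonzero)

text \<open>The estimate \<open>positive_rooted_logderiv\<close> is a weak inequality between
  convergent quantities, so it passes to the limit.\<close>

lemma real_powser_logderiv:
  assumes w: "cmod w \<le> T"
  shows "cmod (w * (deriv (real_powser a) w / real_powser a w)) \<le>
    - (cmod w * Re (deriv (real_powser a) (of_real (cmod w)) / real_powser a (of_real (cmod w))))"
proof (rule tendsto_le[OF sequentially_bot])
  show "\<forall>\<^sub>F m in sequentially. cmod (w * (poly (pderiv (P m)) w / poly (P m) w)) \<le>
    - (cmod w * Re (poly (pderiv (P m)) (of_real (cmod w)) / poly (P m) (of_real (cmod w))))"
    using eventually_poly_nonzero
    by eventually_elim (rule positive_rooted_logderiv[OF pos _ w], blast)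
qed (use w in \<open>intro tendsto_intros logderiv_tendsto; simp\<close>)+

lemma real_powser_logderiv_mono:
  assumes "0 \<le> T"
  shows "Re (deriv (real_powser a) (of_real T) / real_powser a (of_real T)) \<le> Re (deriv (real_powser a) 0 / real_powser a 0)"
proof (rule tendsto_le[OF sequentially_bot])
  show "\<forall>\<^sub>F m in sequentially. Re (poly (pderiv (P m)) (of_real T) / poly (P m) (of_real T))
      \<le> Re (poly (pderiv (P m)) 0 / poly (P m) 0)"
    using eventually_poly_nonzero
    by eventually_elim (rule positive_rooted_logderiv_mono[OF pos _ assms], blast)
qed (use assms in \<open>intro tendsto_intros logderiv_tendsto; simp\<close>)+

end

end

section \<open>Uniform bounds for Euler's product\<close>

text \<open>Every factor satisfies \<open>x + k = k * (1 + x / k) \<le> k * exp (x / k)\<close> for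
  \<open>k > 0\<close>; the exponents add up to \<open>x\<close> times a harmonic number.\<close>

lemma pochhammer_le_exp_harm:
  fixes x :: real
  assumes "x > 0"
  shows "pochhammer x (Suc m) \<le> x * fact m * exp (x * harm m)"
proof (induction m)
  case (Suc m)
  have "x + real (Suc m) = real (Suc m) * (1 + x / real (Suc m))" by (simp add: field_simps)
  also have "\<dots> \<le> real (Suc m) * exp (x / real (Suc m))"
    by (intro mult_left_mono exp_ge_add_one_self) simp
  finally have "x + real (Suc m) \<le> real (Suc m) * exp (x / real (Suc m))" .
  then have "pochhammer x (Suc m) * (x + real (Suc m))
      \<le> x * fact m * exp (x * harm m) * (real (Suc m) * exp (x / real (Suc m)))"
    using Suc assms by (intro mult_mono) auto
  also have "\<dots> = x * fact (Suc m) * exp (x * harm (Suc m))"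
    by (simp add: harm_Suc exp_add distrib_left divide_inverse)
  finally show ?case by (simp add: pochhammer_Suc[of x "Suc m"])
qed (simp add: harm_def)

lemma rGamma_series_nonneg: "x > 0 \<Longrightarrow> rGamma_series x n \<ge> 0" for x :: real
  by (simp add: rGamma_series_def pochhammer_nonneg)

text \<open>The harmonic number exceeds the logarithm by at most 1, which gives a bound independent
  of \<open>m\<close>. At \<open>x = n * \<rho> + \<beta>\<close> it is geometric in
  \<open>n\<close>, as the convergence argument requires.\<close>

lemma rGamma_series_le:
  fixes x :: real
  assumes "x > 0" "m > 0"
  shows "rGamma_series x m \<le> exp (2 * x)"
proof -
  have "rGamma_series x m = pochhammer x (Suc m) / (fact m * exp (x * ln (real m)))"
    by (simp add: rGamma_series_def)
  also have "\<dots> \<le> x * fact m * exp (x * harm m) / (fact m * exp (x * ln (real m)))"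
    by (intro divide_right_mono pochhammer_le_exp_harm assms) simp
  also have "\<dots> = x * exp (x * (harm m - ln (real m)))"
    by (simp add: right_diff_distrib exp_diff)
  also have "\<dots> \<le> exp x * exp (x * 1)"
  proof (intro mult_mono)
    show "x \<le> exp x" using exp_ge_add_one_self[of x] by linarith
    show "exp (x * (harm m - ln (real m))) \<le> exp (x * 1)"
      \<comment> \<open>The sequence \<open>harm m - ln m\<close> decreases from its value 1 at
        \<open>m = 1\<close>.\<close>
      using euler_mascheroni_sequence_decreasing[of 1 m] assms
      by (simp add: harm_def)
  qed auto
  finally show ?thesis by (simp flip: exp_add)
qed

section \<open>Polynomials approximating F\<close>

lemma binomial_over_power_tendsto:
  "(\<lambda>m. real (Suc m choose n) / real (Suc m) ^ n) \<longlonglongrightarrow> 1 / fact n"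
proof -
  have eq: "real (Suc m choose n) / real (Suc m) ^ n
      = (\<Prod>i=0..<n. 1 - real i / real (Suc m)) / fact n" for m
  proof -
    have "(\<Prod>i=0..<n. real (Suc m) - real i) = (\<Prod>i=0..<n. real (Suc m) * (1 - real i / real (Suc m)))"
      by (intro prod.cong) (auto simp: field_simps)
    also have "\<dots> = real (Suc m) ^ n * (\<Prod>i=0..<n. 1 - real i / real (Suc m))"
      by (simp only: prod.distrib) simp
    finally show ?thesis
      by (simp add: binomial_gbinomial gbinomial_prod_rev del: of_nat_Suc)
  qed
  have "(\<lambda>m. (\<Prod>i=0..<n. 1 - real i / real (Suc m)) / fact n) \<longlonglongrightarrow> (\<Prod>i=0..<n. 1 - 0) / fact n"
    by (intro tendsto_intros LIMSEQ_Suc[OF lim_const_over_n]) simp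
  then show ?thesis unfolding eq by simp
qed

lemma positive_rooted_smult: "positive_rooted p \<Longrightarrow> k \<noteq> 0 \<Longrightarrow> positive_rooted (smult k p)"
  by (auto simp: positive_rooted_def)

text \<open>Each factor \<open>n * \<rho> + \<beta> + k\<close> of the Pochhammer symbol is one
  application of \<open>positive_rooted_euler\<close> with \<open>c = \<beta> + k\<close>.\<close>

lemma positive_rooted_pochhammer:
  assumes "positive_rooted p" "\<rho> > 0" "\<beta> > 0"
  shows "\<exists>q. positive_rooted q \<and>
    (\<forall>n. coeff q n = of_real (pochhammer (real n * \<rho> + \<beta>) k) * coeff p n)"
proof (induction k)
  case 0
  then show ?case using assms(1) by auto
next
  case (Suc k)
  then obtain q where q: "positive_rooted q"
    "\<And>n. coeff q n = of_real (pochhammer (real n * \<rho> + \<beta>) k) * coeff p n" by blast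
  let ?q = "smult (of_real (\<beta> + real k)) q + smult (of_real \<rho>) (pCons 0 (pderiv q))"
  have "positive_rooted ?q"
    using assms by (intro positive_rooted_euler q) auto
  moreover have "coeff ?q n = of_real (pochhammer (real n * \<rho> + \<beta>) (Suc k)) * coeff p n" for n
    unfolding coeff_euler q(2) by (simp add: pochhammer_Suc algebra_simps)
  ultimately show ?case by blast
qed

text \<open>These are the coefficients of F, where g'(z) = F(z^2); the factor
  \<open>2 * n + 1\<close> comes from differentiating z^(2n+1).\<close>

definition wright_coeff :: "real \<Rightarrow> real \<Rightarrow> nat \<Rightarrow> real" where
  "wright_coeff \<rho> \<beta> n = Gamma \<beta> * (2 * real n + 1) * (-1) ^ n * rGamma (real n * \<rho> + \<beta>) / fact n"

text \<open>Since \<open>rGamma_series x m\<close> is a Pochhammer symbol divided by m! m^x, at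
  \<open>x = n * \<rho> + \<beta>\<close> the part of the denominator that is a power in
  \<open>n\<close> can be moved into a rescaling of the variable of
  \<open>(1 - s w)^m\<close>.\<close>

lemma wright_poly_exists:
  assumes "\<rho> > 0" "\<beta> > 0" "m > 0"
  shows "\<exists>q. positive_rooted q \<and> (\<forall>n. coeff q n = of_real (Gamma \<beta> * (2 * real n + 1) * (-1) ^ n *
    (real (m choose n) / real m ^ n) * rGamma_series (real n * \<rho> + \<beta>) m))"
proof -
  \<comment> \<open>\<open>s\<close> is m^(-1-\<rho>): its n-th power supplies both the m^(-n)
    beside the binomial coefficient and the m^(-n \<rho>) from Euler's product.\<close>
  define s where "s = 1 / (real m * exp (\<rho> * ln (real m)))"
  have "s > 0" using assms by (simp add: s_def)
  \<comment> \<open>\<open>K\<close> collects the factors independent of \<open>n\<close>.\<close>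
  define K where "K = Gamma \<beta> / (fact m * exp (\<beta> * ln (real m)))"
  have "K > 0" using assms by (simp add: K_def Gamma_real_pos)
  let ?p = "[:1, - complex_of_real s:] ^ m"
  have "\<exists>x>0. z = of_real x" if "poly ?p z = 0" for z
  proof -
    have "of_real s * z = 1" using that by (simp add: poly_power algebra_simps)
    then have "z = of_real (1 / s)" using \<open>s > 0\<close> by (simp add: field_simps)
    then show ?thesis using \<open>s > 0\<close> by (intro exI[of _ "1 / s"]) simp
  qed
  then have "positive_rooted ?p" using \<open>s > 0\<close> by (simp add: positive_rooted_def)
  then obtain q where q: "positive_rooted q"
    \<comment> \<open>The length is \<open>m + 1\<close> because \<open>rGamma_series\<close> at
      \<open>m\<close> uses the Pochhammer symbol with \<open>m + 1\<close> factors.\<close>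
    "\<And>n. coeff q n = of_real (pochhammer (real n * \<rho> + \<beta>) (m + 1)) * coeff ?p n"
    using positive_rooted_pochhammer assms(1,2) by blast
  \<comment> \<open>One more application, with constants 2 and 1, inserts the factor
    \<open>2 * n + 1\<close>.\<close>
  let ?q = "smult (of_real 1) q + smult (of_real 2) (pCons 0 (pderiv q))"
  have "positive_rooted ?q" by (intro positive_rooted_euler q) auto
  then have "positive_rooted (smult (of_real K) ?q)"
    using \<open>K > 0\<close> by (intro positive_rooted_smult) auto
  moreover have "coeff (smult (of_real K) ?q) n = of_real (Gamma \<beta> * (2 * real n + 1) * (-1) ^ n *
    (real (m choose n) / real m ^ n) * rGamma_series (real n * \<rho> + \<beta>) m)" for n
  proof -
    have "coeff ?p n = of_real (real (m choose n) * (- s) ^ n)"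
    proof (cases "n \<le> m")
      case False
      then have "degree ?p < n" using degree_power_le[of "[:1, - complex_of_real s:]" m] \<open>s > 0\<close> by simp
      with False show ?thesis by (simp add: coeff_eq_0 binomial_eq_0)
    qed (simp add: coeff_linear_poly_power)
    then have "coeff (smult (of_real K) ?q) n = of_real (K * ((2 * real n + 1) *
        (pochhammer (real n * \<rho> + \<beta>) (m + 1) * (real (m choose n) * (- s) ^ n))))"
      unfolding coeff_smult coeff_euler q(2) by simp
    also have "(- s) ^ n = (-1) ^ n * (1 / (real m ^ n * exp (real n * \<rho> * ln (real m))))"
      by (subst power_minus)
        (simp add: s_def power_divide power_mult_distrib exp_of_nat_mult[symmetric] mult.assoc)
    also have "K * ((2 * real n + 1) * (pochhammer (real n * \<rho> + \<beta>) (m + 1) * (real (m choose n) *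
        ((-1) ^ n * (1 / (real m ^ n * exp (real n * \<rho> * ln (real m)))))))) =
      Gamma \<beta> * (2 * real n + 1) * (-1) ^ n *
        (real (m choose n) / real m ^ n) * rGamma_series (real n * \<rho> + \<beta>) m"
    proof -
      have "exp ((real n * \<rho> + \<beta>) * ln (real m)) = exp (real n * \<rho> * ln (real m)) * exp (\<beta> * ln (real m))"
        by (simp add: distrib_right exp_add)
      then show ?thesis by (simp add: K_def rGamma_series_def mult_ac)
    qed
    finally show ?thesis .
  qed
  ultimately show ?thesis by blast
qed

lemma wright_poly_sequence:
  assumes "\<rho> > 0" "\<beta> > 0"
  obtains P C q where
    "\<And>n. (\<lambda>m. coeff (P m) n) \<longlonglongrightarrow> of_real (wright_coeff \<rho> \<beta> n)"
    "\<And>m n. cmod (coeff (P m) n) \<le> C * q ^ n / fact n"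
    "\<And>m. positive_rooted (P m)"
proof -
  let ?c = "\<lambda>m n. Gamma \<beta> * (2 * real n + 1) * (-1) ^ n *
    (real (Suc m choose n) / real (Suc m) ^ n) * rGamma_series (real n * \<rho> + \<beta>) (Suc m)"
  have "\<forall>m. \<exists>q. positive_rooted q \<and> (\<forall>n. coeff q n = of_real (?c m n))"
    using wright_poly_exists[OF assms] by blast
  then obtain P where P: "\<And>m. positive_rooted (P m)" "\<And>m n. coeff (P m) n = of_real (?c m n)"
    by metis
  have "(\<lambda>m. ?c m n) \<longlonglongrightarrow> Gamma \<beta> * (2 * real n + 1) * (-1) ^ n * (1 / fact n) * rGamma (real n * \<rho> + \<beta>)" for n
    by (intro tendsto_mult tendsto_const binomial_over_power_tendsto
      LIMSEQ_Suc[OF rGamma_series_LIMSEQ])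
  then have lim: "(\<lambda>m. coeff (P m) n) \<longlonglongrightarrow> of_real (wright_coeff \<rho> \<beta> n)" for n
    unfolding P wright_coeff_def by (intro tendsto_of_real) simp
  \<comment> \<open>The base combines \<open>2 * n + 1 \<le> exp (2 * n)\<close> with the bound
    \<open>exp (2 * (n * \<rho> + \<beta>))\<close> on Euler's product; the binomial quotient gives
    the factorial.\<close>
  have bound: "cmod (coeff (P m) n) \<le> (Gamma \<beta> * exp (2 * \<beta>)) * exp (2 + 2 * \<rho>) ^ n / fact n" for m n
  proof -
    let ?x = "real n * \<rho> + \<beta>"
    have x: "?x > 0" using assms by (simp add: add_nonneg_pos)
    have G: "Gamma \<beta> > 0" using assms by (simp add: Gamma_real_pos)
    have "real (Suc m choose n) * fact n \<le> real (Suc m) ^ n"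
      using binomial_fact_pow[of "Suc m" n] by (metis of_nat_fact of_nat_le_iff of_nat_mult of_nat_power)
    then have 1: "real (Suc m choose n) / real (Suc m) ^ n \<le> 1 / fact n"
      by (simp add: field_simps)
    have 2: "2 * real n + 1 \<le> exp (2 * real n)"
      using exp_ge_add_one_self[of "2 * real n"] by (simp only: add.commute)
    have "cmod (coeff (P m) n) = Gamma \<beta> * (2 * real n + 1) *
        (real (Suc m choose n) / real (Suc m) ^ n) * rGamma_series ?x (Suc m)"
      unfolding P norm_of_real abs_mult
      using G rGamma_series_nonneg[OF x, of "Suc m"] by (simp add: power_abs)
    also have "\<dots> \<le> Gamma \<beta> * exp (2 * real n) * (1 / fact n) * exp (2 * ?x)"
      using G 1 2 rGamma_series_nonneg[OF x, of "Suc m"] rGamma_series_le[OF x, of "Suc m"]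
      by (intro mult_mono mult_nonneg_nonneg order_refl) auto
    also have "\<dots> = (Gamma \<beta> * exp (2 * \<beta>)) * exp (2 + 2 * \<rho>) ^ n / fact n"
      by (simp add: exp_of_nat_mult[symmetric] exp_add[symmetric] algebra_simps)
    finally show ?thesis .
  qed
  show ?thesis using that lim bound P(1) by blast
qed

section \<open>The least root of the real equation\<close>

lemma least_zero:
  fixes h :: "real \<Rightarrow> real"
  assumes cont: "continuous_on UNIV h" and "h 0 > 0" "h T \<le> 0" "T \<ge> 0"
  obtains t where "0 < t" "t \<le> T" "h t = 0" "\<And>s. 0 \<le> s \<Longrightarrow> s < t \<Longrightarrow> h s > 0"
proof -
  have c: "continuous_on A h" for A by (rule continuous_on_subset[OF cont]) simp
  let ?Z = "{0..T} \<inter> h -` {0}"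
  have "?Z \<noteq> {}" using IVT2'[OF assms(3) _ assms(4) c] assms(2) by force
  moreover have "compact ?Z"
    by (intro compact_Int_closed continuous_closed_vimage) (use cont in \<open>auto simp: continuous_on_eq_continuous_at\<close>)
  ultimately obtain t where t: "t \<in> ?Z" and le: "\<And>s. s \<in> ?Z \<Longrightarrow> t \<le> s"
    using compact_attains_inf by metis
  have "h s > 0" if s: "0 \<le> s" "s < t" for s
  proof (rule ccontr)
    assume "\<not> h s > 0"
    then obtain u where "0 \<le> u" "u \<le> s" "h u = 0"
      using IVT2'[OF _ _ s(1) c, of 0] assms(2) by force
    with le[of u] s t show False by simp
  qed
  moreover have "t \<noteq> 0" using t assms(2) by auto
  ultimately show ?thesis using t by (intro that[of t]) auto
qed

text \<open>The root is where \<open>t * f' t / f t\<close> first equals -1/4; with t = r^2 this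
  becomes r g''(r) / g'(r) = -1/2. The assumption \<open>mono\<close> guarantees that this value is
  reached.\<close>

lemma least_zero_quarter:
  fixes f f' :: "real \<Rightarrow> real"
  assumes der: "\<And>t. (f has_real_derivative f' t) (at t)"
    and cont': "continuous_on UNIV f'"
    and "f 0 > 0" "f' 0 < 0"
    and mono: "\<And>T. T \<ge> 0 \<Longrightarrow> (\<And>t. 0 \<le> t \<Longrightarrow> t \<le> T \<Longrightarrow> f t \<noteq> 0) \<Longrightarrow> f' T / f T \<le> f' 0 / f 0"
  obtains t0 where "t0 > 0" "f t0 + 4 * t0 * f' t0 = 0"
    "\<And>t. 0 \<le> t \<Longrightarrow> t < t0 \<Longrightarrow> f t + 4 * t * f' t > 0" "\<And>t. 0 \<le> t \<Longrightarrow> t \<le> t0 \<Longrightarrow> f t > 0"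
proof -
  define k where "k t = f t + 4 * t * f' t" for t
  have contf: "continuous_on UNIV f"
    using der by (meson DERIV_continuous continuous_at_imp_continuous_on)
  have contk: "continuous_on UNIV k"
    unfolding k_def[abs_def] by (intro continuous_intros contf cont')
  \<comment> \<open>\<open>t f(t)^4\<close> has derivative \<open>f(t)^3 k(t)\<close>, so \<open>f\<close> cannot vanish before \<open>k\<close> does.\<close>
  have f_pos: "f t > 0" if k: "\<And>s. 0 \<le> s \<Longrightarrow> s < T \<Longrightarrow> k s > 0" and t: "0 \<le> t" "t \<le> T" for t T
  proof (rule ccontr)
    assume "\<not> f t > 0"
    then have "f t \<le> 0" by simp
    obtain u where u: "0 < u" "u \<le> t" "f u = 0" "\<And>s. 0 \<le> s \<Longrightarrow> s < u \<Longrightarrow> f s > 0"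
      using least_zero[OF contf \<open>f 0 > 0\<close> \<open>f t \<le> 0\<close> t(1)] by blast
    have "((\<lambda>t. t * f t ^ 4) has_real_derivative f t ^ 3 * k t) (at t)" for t
      unfolding k_def by (auto intro!: derivative_eq_intros der simp: power4_eq_xxxx power3_eq_cube algebra_simps)
    \<comment> \<open>\<open>t * f t ^ 4\<close> vanishes at both 0 and \<open>u\<close>, so its
      derivative cannot be positive throughout the interval between them.\<close>
    then obtain v where v: "0 < v" "v < u" "u * f u ^ 4 - 0 * f 0 ^ 4 = (u - 0) * (f v ^ 3 * k v)"
      using MVT2[of 0 u "\<lambda>t. t * f t ^ 4" "\<lambda>t. f t ^ 3 * k t"] u(1) by auto
    have "f v > 0" "k v > 0" using u(2) u(4)[of v] v k[of v] t by auto
    then have "(u - 0) * (f v ^ 3 * k v) > 0" using u by simp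
    then have "u * f u ^ 4 - 0 * f 0 ^ 4 > 0" by (simp only: v(3))
    with u(3) show False by simp
  qed
  \<comment> \<open>At this point the upper bound \<open>t * f' 0 / f 0\<close> for
    \<open>t * f' t / f t\<close> equals -1/4, so \<open>k\<close> cannot stay positive up to and
    including \<open>T\<close>.\<close>
  define T where "T = - f 0 / (4 * f' 0)"
  have "T > 0" unfolding T_def by (rule divide_neg_neg) (use assms(3,4) in auto)
  obtain s where "0 \<le> s" "k s \<le> 0"
  proof (rule ccontr)
    assume "\<not> thesis"
    then have "\<not> (\<exists>s. 0 \<le> s \<and> k s \<le> 0)" using that by blast
    then have k: "k s > 0" if "0 \<le> s" for s using that by force
    have pos: "f t > 0" if "0 \<le> t" for t using f_pos[of t t] k that by simp
    have "f' T / f T \<le> f' 0 / f 0" using mono[of T] pos \<open>T > 0\<close> by force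
    then have "4 * T * (f' T / f T) \<le> 4 * T * (f' 0 / f 0)"
      using \<open>T > 0\<close> by (intro mult_left_mono) auto
    also have "\<dots> = -1" using assms(3,4) by (simp add: T_def)
    finally have "k T \<le> 0" using pos[of T] \<open>T > 0\<close> by (simp add: k_def field_simps)
    with k[of T] \<open>T > 0\<close> show False by simp
  qed
  have "k 0 > 0" using assms(3) by (simp add: k_def)
  obtain t0 where t0: "0 < t0" "t0 \<le> s" "k t0 = 0" "\<And>s. 0 \<le> s \<Longrightarrow> s < t0 \<Longrightarrow> k s > 0"
    using least_zero[OF contk \<open>k 0 > 0\<close> \<open>k s \<le> 0\<close> \<open>0 \<le> s\<close>] by blast
  \<comment> \<open>\<open>f_pos\<close> applies up to and including \<open>t0\<close>, although
    \<open>k t0 = 0\<close>: it asks for positivity of \<open>k\<close> only strictly before its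
    endpoint.\<close>
  show ?thesis using that[of t0] t0 f_pos[of t0] by (simp add: k_def)
qed

section \<open>The derivative of g as a power series in z^2\<close>

lemma wright_coeff_summable:
  fixes z :: "'a::{real_normed_field,banach}"
  assumes "\<rho> > 0" "\<beta> > 0"
  shows "summable (\<lambda>n. of_real (wright_coeff \<rho> \<beta> n) * z ^ n)"
proof -
  obtain P C q where "\<And>n. (\<lambda>m. coeff (P m) n) \<longlonglongrightarrow> of_real (wright_coeff \<rho> \<beta> n)"
    "\<And>m n. cmod (coeff (P m) n) \<le> C * q ^ n / fact n" "\<And>m. positive_rooted (P m)"
    using wright_poly_sequence[OF assms] by blast
  then show ?thesis by (rule summable_coeff_limit)
qed

text \<open>Writing g(z) = z G(z^2), the product rule gives G + 2 w G' at w = z^2. Since w d/dw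
  multiplies the n-th coefficient by \<open>n\<close>, the factor \<open>2 * n + 1\<close>
  appears.\<close>

lemma g_wright_field_derivative:
  assumes "\<rho> > 0" "\<beta> > 0"
  shows "(g_wright \<rho> \<beta> has_field_derivative real_powser (wright_coeff \<rho> \<beta>) (z\<^sup>2)) (at z)"
proof -
  define b where "b n = Gamma \<beta> * (-1) ^ n * rGamma (real n * \<rho> + \<beta>) / fact n" for n
  have a: "wright_coeff \<rho> \<beta> n = (2 * real n + 1) * b n" for n
    by (simp add: wright_coeff_def b_def)
  have summ: "summable (\<lambda>n. complex_of_real (b n) * w ^ n)" for w
  proof (rule summable_comparison_test')
    \<comment> \<open>Convergence at radius \<open>norm w + 1\<close> gives absolute convergence at
      \<open>w\<close>; \<open>b\<close> is dominated by \<open>wright_coeff\<close>.\<close>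
    show "summable (\<lambda>n. norm (complex_of_real (wright_coeff \<rho> \<beta> n) * w ^ n))"
      using powser_insidea[OF wright_coeff_summable[OF assms], of w "of_real (norm w + 1)"]
      by simp
    have "\<bar>b n\<bar> \<le> \<bar>wright_coeff \<rho> \<beta> n\<bar>" for n
      unfolding a abs_mult by (rule mult_left_le_imp_le[of 1]) (auto simp: mult_right_mono mult_le_cancel_right1)
    then show "norm (complex_of_real (b n) * w ^ n) \<le> norm (complex_of_real (wright_coeff \<rho> \<beta> n) * w ^ n)" for n
      by (simp add: norm_mult mult_right_mono)
  qed
  define G where "G w = (\<Sum>n. complex_of_real (b n) * w ^ n)" for w
  define G' where "G' w = (\<Sum>n. diffs (\<lambda>n. complex_of_real (b n)) n * w ^ n)" for w
  have G: "(G has_field_derivative G' w) (at w)" for w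
    unfolding G_def[abs_def] G'_def using summ by (rule termdiffs_strong_converges_everywhere)
  have g: "g_wright \<rho> \<beta> = (\<lambda>z. z * G (z\<^sup>2))"
  proof
    fix z :: complex
    have rG: "rGamma (of_real (real n * \<rho>) + of_real \<beta> :: complex) = of_real (rGamma (real n * \<rho> + \<beta>))" for n
      by (simp flip: rGamma_complex_of_real)
    have G0: "Gamma \<beta> \<noteq> 0" using Gamma_real_pos[OF assms(2)] by linarith
    have eq: "(- (z\<^sup>2)) ^ n * rGamma (of_real (real n * \<rho>) + of_real \<beta>) / of_nat (fact n)
        = inverse (of_real (Gamma \<beta>)) * (of_real (b n) * (z\<^sup>2) ^ n)" for n
      unfolding rG using G0 by (subst power_minus) (simp add: b_def)
    have "of_real (Gamma \<beta>) * wright \<rho> (of_real \<beta>) (- (z\<^sup>2)) = G (z\<^sup>2)"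
    proof -
      have "(\<lambda>n. inverse (of_real (Gamma \<beta>)) * (of_real (b n) * (z\<^sup>2) ^ n)) sums
          (inverse (of_real (Gamma \<beta>)) * G (z\<^sup>2))"
        unfolding G_def by (intro sums_mult summable_sums summ)
      then have "wright \<rho> (of_real \<beta>) (- (z\<^sup>2)) = inverse (of_real (Gamma \<beta>)) * G (z\<^sup>2)"
        unfolding wright_def eq by (simp only: sums_iff)
      with G0 show ?thesis by simp
    qed
    then show "g_wright \<rho> \<beta> z = z * G (z\<^sup>2)" by (simp add: g_wright_def mult.assoc)
  qed
  have G_eq: "G w + 2 * w * G' w = real_powser (wright_coeff \<rho> \<beta>) w" for w
  proof -
    \<comment> \<open>At \<open>n = 0\<close> the truncated exponent \<open>n - Suc 0\<close> is
      harmless, because the factor \<open>of_nat n\<close> vanishes.\<close>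
    have "(\<lambda>n. of_nat n * of_real (b n) * w ^ (n - Suc 0)) sums G' w"
      unfolding G'_def by (intro diffs_equiv termdiff_converges_all summ)
    then have "(\<lambda>n. of_real (b n) * w ^ n + 2 * w * (of_nat n * of_real (b n) * w ^ (n - Suc 0)))
        sums (G w + 2 * w * G' w)"
      unfolding G_def by (intro sums_add sums_mult summable_sums summ)
    moreover have "of_real (b n) * w ^ n + 2 * w * (of_nat n * of_real (b n) * w ^ (n - Suc 0))
        = of_real (wright_coeff \<rho> \<beta> n) * w ^ n" for n
      unfolding a by (cases n) (simp_all add: algebra_simps)
    ultimately show ?thesis
      by (simp add: real_powser_def sums_iff)
  qed
  have "real_powser (wright_coeff \<rho> \<beta>) (z\<^sup>2) = G (z\<^sup>2) + z * (G' (z\<^sup>2) * (2 * z))"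
    unfolding G_eq[symmetric] by (simp add: power2_eq_square)
  then show ?thesis
    unfolding g by (auto intro!: derivative_eq_intros DERIV_chain2[OF G])
qed

section \<open>The radius of uniform convexity\<close>

theorem theorem3:
  fixes \<rho> \<beta> :: real
  assumes "\<rho> > 0" and "\<beta> > 0"
  shows "\<exists>r0::real. r0 > 0
     \<and> 1 + 2 * of_real r0 * deriv (deriv (g_wright \<rho> \<beta>)) (of_real r0)
           / deriv (g_wright \<rho> \<beta>) (of_real r0) = 0
     \<and> (\<forall>r. 0 < r \<and> r < r0 \<longrightarrow>
           1 + 2 * of_real r * deriv (deriv (g_wright \<rho> \<beta>)) (of_real r)
             / deriv (g_wright \<rho> \<beta>) (of_real r) \<noteq> 0)
     \<and> radius_uc (g_wright \<rho> \<beta>) = ereal r0"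
proof -
  define a where "a = wright_coeff \<rho> \<beta>"
  define F where "F = real_powser a"
  define f where "f t = (\<Sum>n. a n * t ^ n)" for t :: real
  define f' where "f' t = (\<Sum>n. diffs a n * t ^ n)" for t :: real
  let ?g = "g_wright \<rho> \<beta>"
  obtain P C q where seq: "\<And>n. (\<lambda>m. coeff (P m) n) \<longlonglongrightarrow> of_real (a n)"
    "\<And>m n. cmod (coeff (P m) n) \<le> C * q ^ n / fact n" "\<And>m. positive_rooted (P m)"
    using wright_poly_sequence[OF assms] unfolding a_def by blast
  have F_real: "F (of_real t) = of_real (f t)" and F'_real: "deriv F (of_real t) = of_real (f' t)" for t
    unfolding F_def f_def f'_def
    by (rule real_powser_of_real[OF seq] deriv_real_powser_of_real[OF seq])+
  have f_nz: "real_powser a (of_real t) \<noteq> 0 \<longleftrightarrow> f t \<noteq> 0" for t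
    using F_real[of t] by (simp add: F_def)
  have G_pos: "Gamma \<beta> > 0" "rGamma \<beta> > 0" "rGamma (\<rho> + \<beta>) > 0"
    using assms by (simp_all add: Gamma_real_pos rGamma_inverse_Gamma)
  \<comment> \<open>These are the first two coefficients, 1 and -3 \<Gamma>(\<beta>) /
    \<Gamma>(\<rho> + \<beta>).\<close>
  have f0: "f 0 > 0" "f' 0 < 0"
    unfolding f_def f'_def powser_zero using G_pos by (simp_all add: a_def wright_coeff_def diffs_def)
  obtain t0 where t0: "t0 > 0" "f t0 + 4 * t0 * f' t0 = 0"
    "\<And>t. 0 \<le> t \<Longrightarrow> t < t0 \<Longrightarrow> f t + 4 * t * f' t > 0" "\<And>t. 0 \<le> t \<Longrightarrow> t \<le> t0 \<Longrightarrow> f t > 0"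
  proof (rule least_zero_quarter[of f f'])
    show "(f has_real_derivative f' t) (at t)" for t
      unfolding f_def[abs_def] f'_def by (rule real_field_derivative[OF seq])
    show "continuous_on UNIV f'"
      unfolding f'_def[abs_def] by (intro continuous_at_imp_continuous_on ballI isCont_real_derivative[OF seq])
    show "f' T / f T \<le> f' 0 / f 0" if "T \<ge> 0" "\<And>t. 0 \<le> t \<Longrightarrow> t \<le> T \<Longrightarrow> f t \<noteq> 0" for T
    proof -
      have "Re (deriv F (of_real T) / F (of_real T)) \<le> Re (deriv F 0 / F 0)"
        unfolding F_def by (rule real_powser_logderiv_mono[OF seq]) (use that f_nz in auto)
      then have "Re (of_real (f' T / f T)) \<le> Re (of_real (f' 0 / f 0))"
        using F_real[of 0] F'_real[of 0] by (simp add: F_real F'_real)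
      then show ?thesis unfolding Re_complex_of_real .
    qed
  qed (use f0 in auto)
  define r0 where "r0 = sqrt t0"
  have r0: "r0 > 0" "r0\<^sup>2 = t0" using t0(1) by (simp_all add: r0_def)
  have dg: "deriv ?g = (\<lambda>z. F (z\<^sup>2))"
    unfolding F_def a_def by (intro ext DERIV_imp_deriv g_wright_field_derivative assms)
  have F_der: "(F has_field_derivative deriv F w) (at w)" for w
    unfolding F_def using real_powser_field_derivative[OF seq, of w] by (metis DERIV_imp_deriv)
  have ddg: "deriv (deriv ?g) z = 2 * z * deriv F (z\<^sup>2)" for z
  proof -
    have "((\<lambda>z. z\<^sup>2) has_field_derivative 2 * z) (at z)"
      by (auto intro!: derivative_eq_intros)
    from DERIV_imp_deriv[OF DERIV_chain2[OF F_der this]]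
    show ?thesis unfolding dg by (simp add: mult_ac)
  qed
  have real_quot: "z * deriv (deriv ?g) z / deriv ?g z = 2 * (z\<^sup>2 * (deriv F (z\<^sup>2) / F (z\<^sup>2)))" for z
    unfolding ddg unfolding dg by (simp add: power2_eq_square)
  have on_real: "of_real r * deriv (deriv ?g) (of_real r) / deriv ?g (of_real r)
      = of_real (2 * (r\<^sup>2 * (f' (r\<^sup>2) / f (r\<^sup>2))))" for r
    unfolding real_quot using F_real[of "r\<^sup>2"] F'_real[of "r\<^sup>2"] by simp
  \<comment> \<open>The range of \<open>r\<close> keeps \<open>f (r^2)\<close> positive. At a zero
    of \<open>f\<close>, division by zero would give 1 on the left and 0 on the right.\<close>
  have eqn: "1 + 2 * of_real r * deriv (deriv ?g) (of_real r) / deriv ?g (of_real r)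
      = of_real ((f (r\<^sup>2) + 4 * r\<^sup>2 * f' (r\<^sup>2)) / f (r\<^sup>2))" if "0 < r" "r \<le> r0" for r
  proof -
    have "r\<^sup>2 \<le> t0" using that by (metis r0(2) power_mono less_imp_le)
    then have "f (r\<^sup>2) > 0" using t0(4) by simp
    have "1 + 2 * of_real r * deriv (deriv ?g) (of_real r) / deriv ?g (of_real r)
        = 1 + 2 * (of_real r * deriv (deriv ?g) (of_real r) / deriv ?g (of_real r))"
      by simp
    also have "\<dots> = of_real (1 + 4 * (r\<^sup>2 * (f' (r\<^sup>2) / f (r\<^sup>2))))"
      unfolding on_real by simp
    also have "1 + 4 * (r\<^sup>2 * (f' (r\<^sup>2) / f (r\<^sup>2))) = (f (r\<^sup>2) + 4 * r\<^sup>2 * f' (r\<^sup>2)) / f (r\<^sup>2)"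
      using \<open>f (r\<^sup>2) > 0\<close> by (simp add: field_simps)
    finally show ?thesis .
  qed
  have inside: "deriv ?g z \<noteq> 0 \<and> cmod (z * deriv (deriv ?g) z / deriv ?g z) < 1 / 2"
    if z: "cmod z < r0" for z
  proof
    have w: "cmod (z\<^sup>2) < t0" using z r0 by (metis norm_ge_zero norm_power power_strict_mono zero_less_numeral)
    have nz: "real_powser a (of_real t) \<noteq> 0" if "0 \<le> t" "t \<le> cmod (z\<^sup>2)" for t
      unfolding f_nz using t0(4)[of t] that w by auto
    show "deriv ?g z \<noteq> 0"
      unfolding dg F_def by (rule real_powser_nonzero[OF seq nz order_refl])
    let ?t = "cmod (z\<^sup>2)"
    have "cmod (z\<^sup>2 * (deriv F (z\<^sup>2) / F (z\<^sup>2))) \<le> - (?t * Re (deriv F (of_real ?t) / F (of_real ?t)))"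
      unfolding F_def by (rule real_powser_logderiv[OF seq nz order_refl])
    also have "\<dots> = - (?t * Re (of_real (f' ?t / f ?t)))"
      by (simp only: F_real F'_real of_real_divide)
    also have "\<dots> = - (?t * f' ?t) / f ?t" by (simp only: Re_complex_of_real) simp
    \<comment> \<open>Strict, because \<open>f t + 4 * t * f' t\<close> is positive before
      \<open>t0\<close>; the factor 2 in \<open>real_quot\<close> turns 1/4 into 1/2.\<close>
    also have "\<dots> < 1 / 4"
      using t0(3)[of ?t] t0(4)[of ?t] w by (simp add: divide_simps)
    finally show "cmod (z * deriv (deriv ?g) z / deriv ?g z) < 1 / 2"
      unfolding real_quot norm_mult[of 2] by simp
  qed
  have an: "?g analytic_on ball 0 r" for r
    using g_wright_field_derivative[OF assms]
    by (subst analytic_on_open) (auto simp: holomorphic_on_open)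
  let ?S = "{r. r > 0 \<and> ?g analytic_on ball 0 r
      \<and> (\<forall>z\<in>ball 0 r. deriv ?g z \<noteq> 0)
      \<and> (\<forall>z\<in>ball 0 r. Re (1 + z * deriv (deriv ?g) z / deriv ?g z)
                         > cmod (z * deriv (deriv ?g) z / deriv ?g z))}"
  have "r0 \<in> ?S"
  proof (intro CollectI conjI ballI r0 an)
    fix z :: complex
    assume "z \<in> ball 0 r0"
    then have z: "cmod z < r0" by simp
    show "deriv ?g z \<noteq> 0" using inside[OF z] by blast
    let ?x = "z * deriv (deriv ?g) z / deriv ?g z"
    \<comment> \<open>The bound 1/2 is exactly what makes \<open>1 - cmod ?x\<close> exceed
      \<open>cmod ?x\<close>.\<close>
    have "Re (1 + ?x) \<ge> 1 - cmod ?x" using abs_Re_le_cmod[of ?x] by simp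
    moreover have "cmod ?x < 1 / 2" using inside[OF z] by blast
    ultimately show "Re (1 + ?x) > cmod ?x" by linarith
  qed
  \<comment> \<open>A larger disc contains the point \<open>r0\<close>, where the quotient is -1/2
    and both sides of the convexity condition equal 1/2. On the open disc of radius
    \<open>r0\<close> itself the condition holds, so the supremum is a maximum.\<close>
  moreover have "r \<le> r0" if r: "r \<in> ?S" for r
  proof (rule ccontr)
    assume "\<not> r \<le> r0"
    then have "of_real r0 \<in> ball (0::complex) r" using r0 by simp
    moreover have "of_real r0 * deriv (deriv ?g) (of_real r0) / deriv ?g (of_real r0) = of_real (- 1 / 2)"
    proof -
      have "2 * (t0 * (f' t0 / f t0)) = - 1 / 2"
        using t0(2) t0(4)[of t0] t0(1) by (simp add: field_simps)
      then show ?thesis unfolding on_real r0(2) by simp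
    qed
    ultimately have "Re (1 + of_real (- 1 / 2)) > cmod (of_real (- 1 / 2))"
      using r by (metis (no_types, lifting) mem_Collect_eq)
    then show False by simp
  qed
  ultimately have "radius_uc ?g = ereal r0"
    unfolding radius_uc_def by (intro cSup_eq_maximum imageI) auto
  moreover have "1 + 2 * of_real r0 * deriv (deriv ?g) (of_real r0) / deriv ?g (of_real r0) = 0"
    unfolding eqn[OF r0(1) order_refl] r0(2) t0(2) by simp
  moreover have "1 + 2 * of_real r * deriv (deriv ?g) (of_real r) / deriv ?g (of_real r) \<noteq> 0"
    if r: "0 < r" "r < r0" for r
  proof -
    have "r\<^sup>2 < t0" using r by (metis r0(2) less_imp_le power_strict_mono zero_less_numeral)
    then have "f (r\<^sup>2) + 4 * r\<^sup>2 * f' (r\<^sup>2) > 0" "f (r\<^sup>2) > 0"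
      using t0(3)[of "r\<^sup>2"] t0(4)[of "r\<^sup>2"] by simp_all
    then have "(f (r\<^sup>2) + 4 * r\<^sup>2 * f' (r\<^sup>2)) / f (r\<^sup>2) \<noteq> 0" by simp
    then show ?thesis
      unfolding eqn[OF r(1) less_imp_le[OF r(2)]] of_real_eq_0_iff .
  qed
  ultimately show ?thesis using r0(1) by blast
qed

end
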